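(* Let $X$ be a set, let $F$ be a set of functions from $X$ to $[0,1]$, and let $0<\epsilon<1$. If there exists $\alpha>0$ such that $\mathrm{fat}_F(\epsilon/2+\alpha)=\infty$, then $F$ is not an $\epsilon$-uniform Glivenko-Cantelli (GC) class.
   Context: For $\epsilon,\delta>0$ and a set $F$ of functions from $X$ to $[0,1]$, $m_{\mathrm{GC},F}(\epsilon,\delta)$ is the least positive integer $n$ such that for all $m\ge n$ and all probability distributions $D$ on $X$, $$D^m\Big\{(x_1,\dots,x_m):\exists f\in F,\ \Big|\frac1m\sum_{i=1}^m f(x_i)-\int_X f\,dD\Big|>\epsilon\Big\}\le\delta,$$ and $m_{\mathrm{GC},F}(\epsilon,\delta)=\infty$ if no such $n$ exists. $F$ is an $\epsilon$-uniform GC class if $m_{\mathrm{GC},F}(\epsilon,\delta)<\infty$ for all $\delta>0$. $F$ $\gamma$-fatly shatters a sequence $(x_1,r_1),\dots,(x_d,r_d)$ in $X\times[0,1]$ if for every $b\in\{0,1\}^d$ there is $f\in F$ with, for all $j$, $f(x_j)\ge r_j+\gamma$ if $b_j=1$ and $f(x_j)\le r_j-\gamma$ if $b_j=0$. $\mathrm{fat}_F(\gamma)$ is the largest length of such a sequence ($\infty$ if unbounded). Convention: issues of measurability are ignored; the reader may assume that $X$ is countable with all subsets measurable. *)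

theory Defs
  imports "HOL-Probability.Probability"
begin

text \<open>
  The set \<open>X\<close> is the carrier of a measurable space \<open>M\<close>, and the distributions on \<open>X\<close> are the
  probability measures on the sigma-algebra of \<open>M\<close>.  Members of a function class have type
  \<open>'a \<Rightarrow> real\<close>; only their values on \<open>space M\<close> matter.
\<close>

definition distributions :: "'a measure \<Rightarrow> 'a measure set" where
  "distributions M = {D. prob_space D \<and> sets D = sets M}"

definition deviation_event ::
    "('a \<Rightarrow> real) set \<Rightarrow> real \<Rightarrow> nat \<Rightarrow> 'a measure \<Rightarrow> (nat \<Rightarrow> 'a) set" where
  "deviation_event F \<epsilon> m D =
     {x \<in> space (PiM {1..m} (\<lambda>_. D)).
        \<exists>f\<in>F. \<bar>(1 / real m) * (\<Sum>i=1..m. f (x i)) - (\<integral>y. f y \<partial>D)\<bar> > \<epsilon>}"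

text \<open>
  The existential quantifier over \<open>F\<close> may make the deviation event non-measurable, and
  \<^const>\<open>emeasure\<close> is 0 on non-measurable sets; hence the outer measure.  On a countable space with
  all subsets measurable it is just the product measure: see the lemma
  \<open>outer_measure_deviation_event_countable\<close> below.
\<close>

definition m_GC :: "'a measure \<Rightarrow> ('a \<Rightarrow> real) set \<Rightarrow> real \<Rightarrow> real \<Rightarrow> enat" where
  "m_GC M F \<epsilon> \<delta> =
     Inf {enat n | n. 0 < n \<and>
       (\<forall>m\<ge>n. \<forall>D\<in>distributions M.
          outer_measure_of (PiM {1..m} (\<lambda>_. D)) (deviation_event F \<epsilon> m D) \<le> ennreal \<delta>)}"

definition uniform_GC_class :: "'a measure \<Rightarrow> ('a \<Rightarrow> real) set \<Rightarrow> real \<Rightarrow> bool" where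
  "uniform_GC_class M F \<epsilon> \<longleftrightarrow> (\<forall>\<delta>>0. m_GC M F \<epsilon> \<delta> < \<infinity>)"

definition fatly_shatters :: "('a \<Rightarrow> real) set \<Rightarrow> real \<Rightarrow> ('a \<times> real) list \<Rightarrow> bool" where
  "fatly_shatters F \<gamma> s \<longleftrightarrow>
     (\<forall>b :: nat \<Rightarrow> bool. \<exists>f\<in>F. \<forall>j<length s.
        (b j \<longrightarrow> f (fst (s ! j)) \<ge> snd (s ! j) + \<gamma>) \<and>
        (\<not> b j \<longrightarrow> f (fst (s ! j)) \<le> snd (s ! j) - \<gamma>))"

definition fat :: "'a set \<Rightarrow> ('a \<Rightarrow> real) set \<Rightarrow> real \<Rightarrow> enat" where
  "fat X F \<gamma> = Sup {enat (length s) | s. set s \<subseteq> X \<times> {0..1} \<and> fatly_shatters F \<gamma> s}"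

lemma outer_measure_deviation_event_countable:
  assumes X: "countable X" and D: "D \<in> distributions (count_space X)"
  shows "outer_measure_of (PiM {1..m} (\<lambda>_. D)) (deviation_event F \<epsilon> m D)
       = emeasure (PiM {1..m} (\<lambda>_. D)) (deviation_event F \<epsilon> m D)"
proof -
  have sets_D: "sets D = Pow X"
    using D by (simp add: distributions_def)
  have space_D: "space D = X"
    using sets_eq_imp_space_eq[of D "count_space X"] D by (simp add: distributions_def)
  let ?P = "PiM {1..m} (\<lambda>_. D)"
  have space_P: "space ?P = PiE {1..m} (\<lambda>_. X)"
    by (simp add: space_PiM space_D)
  have sub: "deviation_event F \<epsilon> m D \<subseteq> space ?P"
    by (auto simp: deviation_event_def)
  have singleton: "{x} \<in> sets ?P" if "x \<in> space ?P" for x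
  proof -
    have x: "x \<in> PiE {1..m} (\<lambda>_. X)"
      using that by (simp only: space_P)
    have "PiE {1..m} (\<lambda>i. {x i}) \<in> sets ?P"
      using PiE_mem[OF x] by (intro sets_PiM_I_finite) (auto simp: sets_D)
    moreover have "PiE {1..m} (\<lambda>i. {x i}) = {x}"
      by (subst PiE_singleton[of x "{1..m}"]) (use x in \<open>simp_all only: PiE_iff\<close>)
    ultimately show ?thesis by simp
  qed
  have "countable (space ?P)"
    unfolding space_P by (rule countable_PiE) (use X in auto)
  then have "countable (deviation_event F \<epsilon> m D)"
    using sub by (rule countable_subset[rotated])
  then have "(\<Union>x\<in>deviation_event F \<epsilon> m D. {x}) \<in> sets ?P"
    by (rule sets.countable_UN'') (use sub singleton in auto)
  then show ?thesis by simp
qed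

end

theory Submission
  imports Defs
begin

text \<open>
  Take \<open>d\<close> much larger than the sample size \<open>m\<close>, points \<open>x\<^sub>j\<close> with levels \<open>r\<^sub>j\<close> (\<open>j < d\<close>) that are
  \<open>\<gamma>\<close>-fatly shattered for \<open>\<gamma> = \<epsilon>/2 + \<alpha>\<close>, and the uniform distribution on the \<open>x\<^sub>j\<close>. A sample visits at
  most \<open>m\<close> indices. One member of \<open>F\<close> is high at the visited indices and low elsewhere, another one
  is low at the visited indices and high elsewhere. Up to an error of order \<open>m/d\<close>, their signed
  deviations are \<open>2\<gamma> + \<Delta>\<close> and \<open>-2\<gamma> + \<Delta>\<close>, where \<open>\<Delta>\<close> is the deviation of the levels \<open>r\<close>, so one of the
  two exceeds \<open>\<epsilon>\<close> in absolute value. Hence every sample is bad, not just a fraction of them.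
\<close>

lemma fat_infinite_obtains_long:
  assumes "fat X F \<gamma> = \<infinity>"
  obtains s where "set s \<subseteq> X \<times> {0..1}" "fatly_shatters F \<gamma> s" "N < length s"
proof -
  have "enat N < fat X F \<gamma>"
    using assms by simp
  then show ?thesis
    using that unfolding fat_def less_Sup_iff by auto
qed

lemma m_GC_finiteE:
  assumes "m_GC M F \<epsilon> \<delta> < \<infinity>"
  obtains n where "0 < n" "\<And>m D. n \<le> m \<Longrightarrow> D \<in> distributions M \<Longrightarrow>
    outer_measure_of (PiM {1..m} (\<lambda>_. D)) (deviation_event F \<epsilon> m D) \<le> ennreal \<delta>"
  using assms that unfolding m_GC_def Inf_less_iff by blast

text \<open>Here \<open>w\<close> is the sample written as indices into \<open>s\<close>,
  repetitions allowed, so it visits at most \<open>m\<close> of them. Prescribing values there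
  shifts an average over all indices by at most \<open>m * (1 + \<gamma>) / length s\<close>, and
  \<open>large\<close> keeps this below \<open>2 * \<gamma> - \<epsilon>\<close>.\<close>

lemma fatly_shatters_sample_deviation:
  fixes F :: "('a \<Rightarrow> real) set" and w :: "nat \<Rightarrow> nat"
  assumes shat: "fatly_shatters F \<gamma> s"
    and s: "set s \<subseteq> X \<times> {0..1}"
    and F: "F \<subseteq> X \<rightarrow> {0..1}"
    and "0 \<le> \<gamma>" "0 < m"
    and w: "w ` {1..m} \<subseteq> {..<length s}"
    and large: "real m * (1 + \<gamma>) < real (length s) * (2 * \<gamma> - \<epsilon>)"
  shows "\<exists>f\<in>F. \<epsilon> < \<bar>1 / real m * (\<Sum>i=1..m. f (fst (s ! w i)))
                    - (\<Sum>j<length s. f (fst (s ! j))) / real (length s)\<bar>"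
proof -
  define d where "d = length s"
  define S where "S = w ` {1..m}"
  define p r where "p j = fst (s ! j)" and "r j = snd (s ! j)" for j
  have S: "S \<subseteq> {..<d}" "finite S" "card S \<le> m"
    using w card_image_le[of "{1..m}" w] by (auto simp: S_def d_def)
  have d: "0 < d"
    using w \<open>0 < m\<close> by (cases d) (auto simp: d_def)
  have pr: "p j \<in> X" "0 \<le> r j" "r j \<le> 1" if "j < d" for j
    using subsetD[OF s nth_mem[OF that[unfolded d_def]]] by (auto simp: p_def r_def)
  obtain f where f: "f \<in> F"
    "\<And>j. j < d \<Longrightarrow> j \<in> S \<Longrightarrow> r j + \<gamma> \<le> f (p j)" "\<And>j. j < d \<Longrightarrow> j \<notin> S \<Longrightarrow> f (p j) \<le> r j - \<gamma>"
    using shat[unfolded fatly_shatters_def, rule_format, of "\<lambda>j. j \<in> S"]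
    unfolding p_def r_def d_def by blast
  obtain g where g: "g \<in> F"
    "\<And>j. j < d \<Longrightarrow> j \<in> S \<Longrightarrow> g (p j) \<le> r j - \<gamma>" "\<And>j. j < d \<Longrightarrow> j \<notin> S \<Longrightarrow> r j + \<gamma> \<le> g (p j)"
    using shat[unfolded fatly_shatters_def, rule_format, of "\<lambda>j. j \<notin> S"]
    unfolding p_def r_def d_def by blast
  have range01: "0 \<le> h (p j)" "h (p j) \<le> 1" if "h \<in> F" "j < d" for h j
    using that F pr(1)[of j] by (auto simp: Pi_iff subset_iff)
  define R where "R = (\<Sum>j<d. r j) / d"
  define Q where "Q = (\<Sum>i=1..m. r (w i)) / m"
  \<comment> \<open>A visited index costs at most \<open>1 + \<gamma>\<close>: there
    \<open>f\<close> may reach 1 while \<open>r j - \<gamma>\<close> may be as low as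
    \<open>- \<gamma>\<close>, and \<open>g\<close> may be 0 while \<open>r j + \<gamma>\<close> may
    be as high as \<open>1 + \<gamma>\<close>.\<close>
  define e where "e = m * (1 + \<gamma>) / d"
  have "(\<Sum>j<d. if j \<in> S then 1 + \<gamma> else 0) = card S * (1 + \<gamma>)"
    using S by (simp add: sum.If_cases Int_absorb1)
  also have "\<dots> \<le> m * (1 + \<gamma>)"
    using S \<open>0 \<le> \<gamma>\<close> by (intro mult_right_mono) auto
  finally have err: "(\<Sum>j<d. if j \<in> S then 1 + \<gamma> else 0) \<le> m * (1 + \<gamma>)" .
  have mean_f: "(\<Sum>j<d. f (p j)) / d \<le> R - \<gamma> + e"
  proof -
    have "(\<Sum>j<d. f (p j)) \<le> (\<Sum>j<d. r j - \<gamma> + (if j \<in> S then 1 + \<gamma> else 0))"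
      using range01[OF f(1)] f(3) pr by (intro sum_mono) (auto intro: add_increasing)
    also have "\<dots> \<le> (\<Sum>j<d. r j) - d * \<gamma> + m * (1 + \<gamma>)"
      using err by (simp add: sum.distrib sum_subtractf)
    finally have "(\<Sum>j<d. f (p j)) / d \<le> ((\<Sum>j<d. r j) - d * \<gamma> + m * (1 + \<gamma>)) / d"
      by (rule divide_right_mono) simp
    then show ?thesis
      using d by (simp add: R_def e_def add_divide_distrib diff_divide_distrib)
  qed
  have mean_g: "R + \<gamma> - e \<le> (\<Sum>j<d. g (p j)) / d"
  proof -
    have "(\<Sum>j<d. r j) + d * \<gamma> - m * (1 + \<gamma>) \<le> (\<Sum>j<d. r j + \<gamma> - (if j \<in> S then 1 + \<gamma> else 0))"
      using err by (simp add: sum.distrib sum_subtractf)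
    also have "\<dots> \<le> (\<Sum>j<d. g (p j))"
    proof (intro sum_mono)
      fix j assume "j \<in> {..<d}"
      then show "r j + \<gamma> - (if j \<in> S then 1 + \<gamma> else 0) \<le> g (p j)"
        using range01[OF g(1), of j] g(3)[of j] pr[of j] by auto
    qed
    finally have "((\<Sum>j<d. r j) + d * \<gamma> - m * (1 + \<gamma>)) / d \<le> (\<Sum>j<d. g (p j)) / d"
      by (rule divide_right_mono) simp
    then show ?thesis
      using d by (simp add: R_def e_def add_divide_distrib diff_divide_distrib)
  qed
  have wS: "w i \<in> S" "w i < d" if "i \<in> {1..m}" for i
    using that S(1) unfolding S_def by blast+
  \<comment> \<open>No error term arises here, since every sampled index lies in
    \<open>S\<close>.\<close>
  have sample_f: "Q + \<gamma> \<le> 1 / m * (\<Sum>i=1..m. f (p (w i)))"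
  proof -
    have "(\<Sum>i=1..m. r (w i) + \<gamma>) \<le> (\<Sum>i=1..m. f (p (w i)))"
      using wS f(2) by (intro sum_mono) blast
    then have "(\<Sum>i=1..m. r (w i) + \<gamma>) / m \<le> (\<Sum>i=1..m. f (p (w i))) / m"
      by (rule divide_right_mono) simp
    then show ?thesis
      using \<open>0 < m\<close> by (simp add: Q_def sum.distrib add_divide_distrib)
  qed
  have sample_g: "1 / m * (\<Sum>i=1..m. g (p (w i))) \<le> Q - \<gamma>"
  proof -
    have "(\<Sum>i=1..m. g (p (w i))) \<le> (\<Sum>i=1..m. r (w i) - \<gamma>)"
      using wS g(2) by (intro sum_mono) blast
    then have "(\<Sum>i=1..m. g (p (w i))) / m \<le> (\<Sum>i=1..m. r (w i) - \<gamma>) / m"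
      by (rule divide_right_mono) simp
    then show ?thesis
      using \<open>0 < m\<close> by (simp add: Q_def sum_subtractf diff_divide_distrib)
  qed
  have "e < 2 * \<gamma> - \<epsilon>"
    using large d by (simp add: e_def d_def field_simps)
  \<comment> \<open>The deviation of \<open>f\<close> is at least
    \<open>Q - R + 2 * \<gamma> - e\<close>, that of \<open>g\<close> at most
    \<open>Q - R - 2 * \<gamma> + e\<close>. The sign of \<open>Q - R\<close> decides which one to
    take.\<close>
  then have "\<epsilon> < \<bar>1 / m * (\<Sum>i=1..m. f (p (w i))) - (\<Sum>j<d. f (p j)) / d\<bar>
      \<or> \<epsilon> < \<bar>1 / m * (\<Sum>i=1..m. g (p (w i))) - (\<Sum>j<d. g (p j)) / d\<bar>"
    using mean_f mean_g sample_f sample_g by linarith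
  then show ?thesis
    using f(1) g(1) unfolding p_def d_def by blast
qed

text \<open>
  Pulling back along \<open>p\<close> avoids assuming that points are measurable: a measurable superset of the
  event has the whole index space as preimage.
\<close>

lemma outer_measure_PiM_distr_ge_1:
  assumes P: "prob_space P" and p: "p \<in> measurable P M" and "finite I"
    and E: "\<And>w. w \<in> space (PiM I (\<lambda>_. P)) \<Longrightarrow> compose I p w \<in> E"
  shows "1 \<le> outer_measure_of (PiM I (\<lambda>_. distr P M p)) E"
  unfolding outer_measure_of_def
proof (rule INF_greatest)
  let ?D = "distr P M p" and ?c = "compose I p"
  interpret prob: prob_space "PiM I (\<lambda>_. P)"
    using P by (intro prob_space_PiM)
  fix B assume B: "B \<in> {B \<in> sets (PiM I (\<lambda>_. ?D)). E \<subseteq> B}"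
  have p': "p \<in> measurable P ?D"
    using p by simp
  \<comment> \<open>As a target, \<open>?D\<close> matters only through its sigma-algebra, which is
    that of \<open>M\<close>. This lets the product of the image measures be read as the image of
    the product.\<close>
  have "distr P ?D p = ?D"
    by (rule distr_cong) auto
  then have prod: "distr (PiM I (\<lambda>_. P)) (PiM I (\<lambda>_. ?D)) ?c = PiM I (\<lambda>_. ?D)"
    using distr_PiM_finite_prob_space'[OF \<open>finite I\<close>, of "\<lambda>_. P" "\<lambda>_. ?D" p]
      P p' prob_space.prob_space_distr[OF P p] by simp
  have c: "?c \<in> measurable (PiM I (\<lambda>_. P)) (PiM I (\<lambda>_. ?D))"
    unfolding compose_def using p' by measurable
  have "emeasure (PiM I (\<lambda>_. ?D)) B
      = emeasure (PiM I (\<lambda>_. P)) (?c -` B \<inter> space (PiM I (\<lambda>_. P)))"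
    using emeasure_distr[OF c, of B] B unfolding prod by simp
  also have "?c -` B \<inter> space (PiM I (\<lambda>_. P)) = space (PiM I (\<lambda>_. P))"
    using B E by blast
  finally show "1 \<le> emeasure (PiM I (\<lambda>_. ?D)) B"
    by (simp add: prob.emeasure_space_1)
qed

theorem theorem22:
  fixes M :: "'a measure" and F :: "('a \<Rightarrow> real) set" and \<epsilon> :: real
  assumes "F \<subseteq> borel_measurable M \<inter> (space M \<rightarrow> {0..1})"
    and "0 < \<epsilon>" and "\<epsilon> < 1"
    and "\<exists>\<alpha>>0. fat (space M) F (\<epsilon> / 2 + \<alpha>) = \<infinity>"
  shows "\<not> uniform_GC_class M F \<epsilon>"
proof
  assume "uniform_GC_class M F \<epsilon>"
  \<comment> \<open>Any positive value below 1 would do in place of 1/2, as the bad event will have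
    outer measure at least 1.\<close>
  then have "m_GC M F \<epsilon> (1 / 2) < \<infinity>"
    by (simp add: uniform_GC_class_def)
  then obtain m where "0 < m" and bound: "\<And>D. D \<in> distributions M \<Longrightarrow>
      outer_measure_of (PiM {1..m} (\<lambda>_. D)) (deviation_event F \<epsilon> m D) \<le> ennreal (1 / 2)"
    by (rule m_GC_finiteE) blast
  obtain \<alpha> where "0 < \<alpha>" and inf: "fat (space M) F (\<epsilon> / 2 + \<alpha>) = \<infinity>"
    using assms(4) by blast
  define \<gamma> where "\<gamma> = \<epsilon> / 2 + \<alpha>"
  \<comment> \<open>Since \<open>2 * \<gamma> - \<epsilon> = 2 * \<alpha>\<close>, this bound on the
    length is exactly the condition \<open>large\<close>.\<close>
  obtain N :: nat where N: "m * (1 + \<gamma>) / (2 * \<alpha>) < N"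
    using reals_Archimedean2 by blast
  obtain s where s: "set s \<subseteq> space M \<times> {0..1}" and shat: "fatly_shatters F \<gamma> s"
    and "N < length s"
    using fat_infinite_obtains_long[OF inf] unfolding \<gamma>_def by blast
  have "m * (1 + \<gamma>) / (2 * \<alpha>) < length s"
    using N \<open>N < length s\<close> by linarith
  then have large: "real m * (1 + \<gamma>) < real (length s) * (2 * \<gamma> - \<epsilon>)"
    using \<open>0 < \<alpha>\<close> by (simp add: \<gamma>_def pos_divide_less_eq algebra_simps)
  have ne: "{..<length s} \<noteq> {}"
    using \<open>N < length s\<close> by auto
  \<comment> \<open>Sampling indices instead of points makes every set measurable and spares a proof
    that the shattered points are distinct.\<close>
  define P where "P = uniform_count_measure {..<length s}"
  define p where "p j = fst (s ! j)" for j
  define D where "D = distr P M p"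
  have P: "prob_space P"
    unfolding P_def using ne by (intro prob_space_uniform_count_measure) auto
  have "p j \<in> space M" if "j < length s" for j
    using subsetD[OF s nth_mem[OF that]] by (auto simp: p_def)
  then have p: "p \<in> measurable P M"
    by (auto simp: P_def measurable_def space_uniform_count_measure sets_uniform_count_measure)
  have D: "D \<in> distributions M"
    using prob_space.prob_space_distr[OF P p] by (simp add: distributions_def D_def)
  have mean: "(\<integral>y. f y \<partial>D) = (\<Sum>j<length s. f (p j)) / length s" if "f \<in> F" for f
  proof -
    have "(\<integral>y. f y \<partial>D) = (\<integral>j. f (p j) \<partial>P)"
      unfolding D_def using p that assms(1) by (intro integral_distr) auto
    also have "\<dots> = (\<Sum>j<length s. f (p j)) / length s"
      by (simp add: P_def uniform_count_measure_def lebesgue_integral_point_measure_finite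
          sum_divide_distrib)
    finally show ?thesis .
  qed
  have "compose {1..m} p w \<in> deviation_event F \<epsilon> m D" if "w \<in> space (PiM {1..m} (\<lambda>_. P))" for w
  proof -
    have w: "w ` {1..m} \<subseteq> {..<length s}"
      using that by (auto simp: space_PiM P_def space_uniform_count_measure PiE_iff)
    have sum: "(\<Sum>i=1..m. f (compose {1..m} p w i)) = (\<Sum>i=1..m. f (p (w i)))" for f :: "'a \<Rightarrow> real"
      by (intro sum.cong) (auto simp: compose_def)
    have "compose {1..m} p w \<in> space (PiM {1..m} (\<lambda>_. D))"
      using that measurable_space[OF p] by (auto simp: space_PiM D_def compose_def PiE_iff)
    moreover have "\<exists>f\<in>F. \<epsilon> < \<bar>1 / real m * (\<Sum>i=1..m. f (p (w i)))
        - (\<Sum>j<length s. f (p j)) / real (length s)\<bar>"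
      unfolding p_def using assms \<open>0 < \<alpha>\<close> \<open>0 < m\<close>
      by (intro fatly_shatters_sample_deviation[OF shat s _ _ _ w large]) (auto simp: \<gamma>_def)
    ultimately show ?thesis
      unfolding deviation_event_def mem_Collect_eq sum using mean by metis
  qed
  then have "1 \<le> outer_measure_of (PiM {1..m} (\<lambda>_. D)) (deviation_event F \<epsilon> m D)"
    unfolding D_def by (intro outer_measure_PiM_distr_ge_1[OF P p]) auto
  also have "\<dots> \<le> ennreal (1 / 2)"
    by (rule bound[OF D])
  finally have "ennreal 1 \<le> ennreal (1 / 2)"
    unfolding ennreal_1 .
  then show False
    by (subst (asm) ennreal_le_iff) auto
qed

end
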